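(* Let $k$ and $n$ be positive integers. If $\mathcal{L}$ is a set of $k$-MOLS$(n)$, then $$\zeta(G(\mathcal{L})) \geq \frac{2(n-1)}{k+2}.$$
   Context: A latin square of order $n$ is an $n\times n$ array with entries from a set of $n$ symbols (taken to be $[n]=\{1,\dots,n\}$) such that each symbol occurs exactly once in each row and in each column. Two latin squares $A,B$ of order $n$ are orthogonal if the $n^2$ pairs $(A[i,j],B[i,j])$ are distinct. A set of $k$-MOLS$(n)$ is a set of $k$ pairwise orthogonal latin squares of order $n$ (for $k=1$, a single latin square). The latin square graph $G(\mathcal{L})$ of a set $\mathcal{L}$ of $k$-MOLS$(n)$ is the graph whose $n^2$ vertices are the cells $(i,j)\in[n]\times[n]$, where two distinct cells are adjacent if they share a row, share a column, or contain the same symbol in at least one of the $k$ latin squares. Localization game on a graph $G$ with $m$ cops: the robber moves first, choosing a vertex, and is invisible to the cops throughout. In each round, after the robber's move, the cops choose vertices $u_1,\dots,u_m$ (on each turn each cop may move to any vertex of the graph) and learn the distance vector $(d_1,\dots,d_m)$, where $d_i$ is the graph distance from $u_i$ to the robber's current vertex. Then, in the next round, the robber moves to an adjacent vertex or stays put, and the cops choose vertices and probe again, and so on. The cops win if they have a strategy that determines, after finitely many rounds and using all the information obtained so far, the vertex the robber occupies; the robber is omniscient, i.e. knows the entire strategy of the cops. The localization number $\zeta(G)$ is the least positive integer $m$ for which $m$ cops have a winning strategy. *)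

theory Defs
  imports
    "HOL-Library.FuncSet"
    "Graph_Theory.Pair_Digraph"
    "Graph_Theory.Shortest_Path"
begin

section \<open>Latin squares and MOLS\<close>

definition cells :: "nat \<Rightarrow> (nat \<times> nat) set" where
  "cells n = {1..n} \<times> {1..n}"

text \<open>
  An array of order \<open>n\<close> is an extensional function on \<open>cells n\<close>, so that equality of arrays is
  equality of entries and the cardinality of a set of arrays is the intended one.
\<close>

definition latin_square :: "nat \<Rightarrow> (nat \<times> nat \<Rightarrow> nat) \<Rightarrow> bool" where
  "latin_square n A \<longleftrightarrow>
     A \<in> cells n \<rightarrow>\<^sub>E {1..n} \<and>
     (\<forall>i\<in>{1..n}. \<forall>s\<in>{1..n}. \<exists>!j. j \<in> {1..n} \<and> A (i, j) = s) \<and>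
     (\<forall>j\<in>{1..n}. \<forall>s\<in>{1..n}. \<exists>!i. i \<in> {1..n} \<and> A (i, j) = s)"

definition orthogonal_squares ::
    "nat \<Rightarrow> (nat \<times> nat \<Rightarrow> nat) \<Rightarrow> (nat \<times> nat \<Rightarrow> nat) \<Rightarrow> bool" where
  "orthogonal_squares n A B \<longleftrightarrow> inj_on (\<lambda>c. (A c, B c)) (cells n)"

definition is_MOLS :: "nat \<Rightarrow> nat \<Rightarrow> (nat \<times> nat \<Rightarrow> nat) set \<Rightarrow> bool" where
  "is_MOLS k n L \<longleftrightarrow>
     finite L \<and> card L = k \<and> (\<forall>A\<in>L. latin_square n A) \<and> pairwise (orthogonal_squares n) L"

definition latin_square_graph ::
    "nat \<Rightarrow> (nat \<times> nat \<Rightarrow> nat) set \<Rightarrow> (nat \<times> nat) pair_pre_digraph" where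
  "latin_square_graph n L =
     \<lparr> pverts = cells n,
       parcs = {(c, d). c \<in> cells n \<and> d \<in> cells n \<and> c \<noteq> d \<and>
                  (fst c = fst d \<or> snd c = snd d \<or> (\<exists>A\<in>L. A c = A d))} \<rparr>"

lemma pair_graph_latin_square_graph: "pair_graph (latin_square_graph n L)"
proof
  have "parcs (latin_square_graph n L) \<subseteq> cells n \<times> cells n"
    by (auto simp: latin_square_graph_def)
  then show "finite (parcs (latin_square_graph n L))"
    by (rule finite_subset) (simp add: cells_def)
  show "symmetric (with_proj (latin_square_graph n L))"
    unfolding symmetric_def sym_def with_proj_simps
    by (simp add: latin_square_graph_def) metis
qed (auto simp: latin_square_graph_def cells_def)


section \<open>The localization game\<close>

text \<open>
  A finite simple graph is a \<open>pair_graph\<close>: every edge is represented by its two arcs.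
  The graph distance is the library's shortest-path distance with every arc of weight one.
\<close>

definition graph_dist :: "'a pair_pre_digraph \<Rightarrow> 'a \<Rightarrow> 'a \<Rightarrow> ereal" where
  "graph_dist G u v = wf_digraph.\<mu> (with_proj G) (\<lambda>_. 1) u v"

text \<open>\<open>r t\<close> is the robber's vertex when the cops make their probe of round \<open>t\<close>.\<close>

definition robber_walk :: "'a pair_pre_digraph \<Rightarrow> (nat \<Rightarrow> 'a) \<Rightarrow> bool" where
  "robber_walk G r \<longleftrightarrow>
     r 0 \<in> pverts G \<and> (\<forall>t. r (Suc t) = r t \<or> (r t, r (Suc t)) \<in> parcs G)"

text \<open>
  A strategy of the cops maps the list of the distance vectors received so far (oldest first) to
  the vertices probed next. The earlier probes are themselves determined by the strategy and the
  earlier answers, so they need not be recorded.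
\<close>

type_synonym 'a strategy = "ereal list list \<Rightarrow> 'a list"

definition cop_strategy :: "'a pair_pre_digraph \<Rightarrow> nat \<Rightarrow> 'a strategy \<Rightarrow> bool" where
  "cop_strategy G m \<sigma> \<longleftrightarrow> (\<forall>h. length (\<sigma> h) = m \<and> set (\<sigma> h) \<subseteq> pverts G)"

text \<open>The answers to the probes of the first \<open>t\<close> rounds, i.e. of the rounds before round \<open>t\<close>.\<close>

primrec answers ::
    "'a pair_pre_digraph \<Rightarrow> 'a strategy \<Rightarrow> (nat \<Rightarrow> 'a) \<Rightarrow> nat \<Rightarrow> ereal list list" where
  "answers G \<sigma> r 0 = []"
| "answers G \<sigma> r (Suc t) =
     answers G \<sigma> r t @ [map (\<lambda>u. graph_dist G u (r t)) (\<sigma> (answers G \<sigma> r t))]"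

text \<open>
  The robber is located in round \<open>t\<close> if all walks of the robber that are consistent with
  the answers up to and including round \<open>t\<close> are at the same vertex in that round.
\<close>

definition located :: "'a pair_pre_digraph \<Rightarrow> 'a strategy \<Rightarrow> (nat \<Rightarrow> 'a) \<Rightarrow> nat \<Rightarrow> bool" where
  "located G \<sigma> r t \<longleftrightarrow>
     (\<forall>r'. robber_walk G r' \<and> answers G \<sigma> r' (Suc t) = answers G \<sigma> r (Suc t) \<longrightarrow> r' t = r t)"

text \<open>Omniscience of the robber: the walk is quantified after the strategy.\<close>

definition cops_win :: "'a pair_pre_digraph \<Rightarrow> nat \<Rightarrow> bool" where
  "cops_win G m \<longleftrightarrow>
     (\<exists>\<sigma>. cop_strategy G m \<sigma> \<and> (\<forall>r. robber_walk G r \<longrightarrow> (\<exists>t. located G \<sigma> r t)))"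

definition localization_number :: "'a pair_pre_digraph \<Rightarrow> nat" where
  "localization_number G = (LEAST m. 0 < m \<and> cops_win G m)"

text \<open>The minimum is attained: probing every vertex wins at once.\<close>

lemma graph_dist_eq_0_iff:
  assumes "pair_graph G" "u \<in> pverts G"
  shows "graph_dist G u v = 0 \<longleftrightarrow> u = v"
proof -
  interpret pair_graph G by fact
  have cost: "awalk_cost (\<lambda>_. 1) p = real (length p)" for p :: "('a \<times> 'a) list"
    by (induction p) auto
  show ?thesis
  proof
    assume 0: "graph_dist G u v = 0"
    show "u = v"
    proof (rule ccontr)
      assume "u \<noteq> v"
      then have "1 \<le> length p" if "awalk u p v" for p
        using that by (cases p) (auto simp: awalk_Nil_iff)
      then have "1 \<le> \<mu> (\<lambda>_. 1) u v"
        unfolding \<mu>_def cost by (intro INF_greatest) auto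
      with 0 show False by (simp add: graph_dist_def)
    qed
  next
    assume "u = v"
    with assms have "awalk u [] v" by (simp add: awalk_Nil_iff)
    then have "\<mu> (\<lambda>_. 1) u v \<le> 0"
      using min_cost_le_walk_cost[of u "[]" v "\<lambda>_. 1"] by (simp add: cost zero_ereal_def)
    moreover have "0 \<le> \<mu> (\<lambda>_. 1) u v"
      unfolding \<mu>_def cost by (intro INF_greatest) auto
    ultimately show "graph_dist G u v = 0" by (simp add: graph_dist_def)
  qed
qed

lemma cops_win_card_verts:
  assumes "pair_graph G"
  shows "cops_win G (card (pverts G))"
proof -
  interpret pair_graph G by fact
  obtain vs where vs: "set vs = pverts G" "length vs = card (pverts G)"
    using finite_distinct_list[OF pair_finite_verts] distinct_card by metis
  have "located G (\<lambda>_. vs) r 0" if r: "robber_walk G r" for r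
    unfolding located_def
  proof (intro allI impI)
    fix r' assume *: "robber_walk G r' \<and> answers G (\<lambda>_. vs) r' (Suc 0) = answers G (\<lambda>_. vs) r (Suc 0)"
    have r0: "r 0 \<in> pverts G" using r by (simp add: robber_walk_def)
    have "graph_dist G (r 0) (r' 0) = graph_dist G (r 0) (r 0)"
      using * r0 vs by (simp add: map_eq_conv)
    then show "r' 0 = r 0"
      using graph_dist_eq_0_iff[OF assms r0] by metis
  qed
  then show ?thesis
    unfolding cops_win_def cop_strategy_def using vs by (intro exI[of _ "\<lambda>_. vs"]) auto
qed

lemma localization_number_attained:
  assumes "pair_graph G" "pverts G \<noteq> {}"
  shows "0 < localization_number G \<and> cops_win G (localization_number G)"
proof -
  interpret pair_graph G by fact
  have "0 < card (pverts G) \<and> cops_win G (card (pverts G))"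
    using assms cops_win_card_verts pair_finite_verts by (simp add: card_gt_0_iff)
  then show ?thesis
    unfolding localization_number_def by (rule LeastI)
qed

end

(* The cells of one row form a clique, so the robber can confine itself to that row and jump anywhere
   in it in every round. A probed cell u splits the row into two parts of constant distance to u, one of
   which (the touched part) has at most k + 1 cells, since u meets a row not containing it in one cell for
   each of the k + 1 other parallel classes. If m probes separate all n cells of the row, then at most one
   cell is touched by no probe and at most m cells are touched by a single probe. Counting incidences
   gives 2 n <= m (k + 1) + m + 2. So with fewer cops some two cells of the row always receive the same
   answers, and the robber moves to one of them. *)
theory Submission
  imports Defs
begin

section \<open>A robber confined to a clique in the localization game\<close>

lemma answers_cong:
  assumes "\<And>s. s < t \<Longrightarrow> r s = r' s"
  shows "answers G \<sigma> r t = answers G \<sigma> r' t"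
  using assms by (induction t) auto

text \<open>Inside the clique \<open>K\<close> every jump is legal, so earlier positions never
  restrict the next one. Knowing the strategy, the robber foresees each probe and sits on one of two
  twins that this probe cannot tell apart.\<close>

lemma not_cops_win_if_clique:
  assumes K: "K \<subseteq> pverts G"
    and clique: "\<And>u v. u \<in> K \<Longrightarrow> v \<in> K \<Longrightarrow> u \<noteq> v \<Longrightarrow> (u, v) \<in> parcs G"
    and twins: "\<And>us. length us = m \<Longrightarrow> set us \<subseteq> pverts G \<Longrightarrow>
      \<exists>p\<in>K. \<exists>q\<in>K. p \<noteq> q \<and> (\<forall>u\<in>set us. graph_dist G u p = graph_dist G u q)"
  shows "\<not> cops_win G m"
proof
  assume "cops_win G m"
  then obtain \<sigma> where \<sigma>: "\<And>h. length (\<sigma> h) = m" "\<And>h. set (\<sigma> h) \<subseteq> pverts G"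
    and win: "\<And>r. robber_walk G r \<Longrightarrow> \<exists>t. located G \<sigma> r t"
    unfolding cops_win_def cop_strategy_def by blast
  have "\<forall>h. \<exists>p q. p \<in> K \<and> q \<in> K \<and> p \<noteq> q \<and>
      (\<forall>u\<in>set (\<sigma> h). graph_dist G u p = graph_dist G u q)"
    using twins \<sigma> by blast
  then obtain p q where pq: "\<And>h. p h \<in> K" "\<And>h. q h \<in> K" "\<And>h. p h \<noteq> q h"
    "\<And>h u. u \<in> set (\<sigma> h) \<Longrightarrow> graph_dist G u (p h) = graph_dist G u (q h)"
    by metis
  have walk: "robber_walk G r" if "\<And>t. r t \<in> K" for r
    unfolding robber_walk_def using that clique subsetD[OF K] by metis
  \<comment> \<open>\<open>H\<close> is the answer history produced when the robber always sits on
    \<open>p\<close>. The next position depends on the history so far, so the history is built by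
    recursion first and the walk \<open>r\<close> is read off from it.\<close>
  define H where "H = rec_nat [] (\<lambda>_ h. h @ [map (\<lambda>u. graph_dist G u (p h)) (\<sigma> h)])"
  define r where "r t = p (H t)" for t
  have answers_r: "answers G \<sigma> r t = H t" for t
    by (induction t) (simp_all add: H_def r_def)
  obtain t where t: "located G \<sigma> r t"
    using win[OF walk, of r] pq(1) by (auto simp: r_def)
  \<comment> \<open>The history before round \<open>t\<close> ignores the position in round
    \<open>t\<close>, so both walks face the same probe there, and the twin \<open>q\<close> gives
    the same answers as \<open>p\<close>. Both walks stay in \<open>K\<close>.\<close>
  define r' where "r' = r(t := q (H t))"
  have "answers G \<sigma> r' t = H t"
    using answers_cong[of t r' r] answers_r by (simp add: r'_def)
  then have "answers G \<sigma> r' (Suc t) = answers G \<sigma> r (Suc t)"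
    using pq(4) answers_r by (simp add: r'_def r_def)
  moreover have "robber_walk G r'"
    using pq by (intro walk) (simp add: r'_def r_def)
  ultimately have "r' t = r t"
    using t unfolding located_def by blast
  then show False
    using pq(3)[of "H t"] by (simp add: r'_def r_def)
qed

section \<open>Counting for separating families of small sets\<close>

text \<open>Double counting of the pairs \<open>v \<in> T i\<close>. By injectivity only one point
  has an empty index set, and the points with singleton index sets inject into \<open>I\<close>;
  every other point is counted at least twice.\<close>

lemma separating_family_card_bound:
  fixes T :: "'i \<Rightarrow> 'a set"
  assumes "finite R" "finite I"
    and small: "\<And>i. i \<in> I \<Longrightarrow> T i \<subseteq> R \<and> card (T i) \<le> c"
    and inj: "inj_on (\<lambda>v. {i \<in> I. v \<in> T i}) R"
  shows "2 * card R \<le> card I * (c + 1) + 2"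
proof -
  define S where "S v = {i \<in> I. v \<in> T i}" for v
  define R0 where "R0 = {v \<in> R. S v = {}}"
  define R1 where "R1 = {v \<in> R. card (S v) = 1}"
  have inj: "inj_on S R"
    using inj by (simp add: S_def[abs_def])
  have fin: "finite (S v)" for v
    using assms by (simp add: S_def)
  have "card R0 \<le> card {{} :: 'i set}"
    by (rule card_inj_on_le[of S]) (auto simp: R0_def intro: inj_on_subset[OF inj])
  then have R0: "card R0 \<le> 1" by simp
  have "card R1 \<le> card ((\<lambda>i. {i}) ` I)"
    using \<open>finite I\<close>
    by (intro card_inj_on_le[of S])
       (auto simp: R1_def S_def card_1_singleton_iff intro: inj_on_subset[OF inj])
  also have "\<dots> \<le> card I"
    using \<open>finite I\<close> by (rule card_image_le)
  finally have R1: "card R1 \<le> card I" .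
  have "(\<Sum>v\<in>R. card (S v)) = (\<Sum>v\<in>R. \<Sum>i\<in>I. if v \<in> T i then 1 else 0)"
    using \<open>finite I\<close> by (simp add: S_def sum.If_cases Int_def)
  also have "\<dots> = (\<Sum>i\<in>I. \<Sum>v\<in>R. if v \<in> T i then 1 else 0)"
    by (rule sum.swap)
  also have "\<dots> = (\<Sum>i\<in>I. card (T i))"
  proof (rule sum.cong)
    fix i assume "i \<in> I"
    then have "R \<inter> T i = T i" using small by blast
    then show "(\<Sum>v\<in>R. if v \<in> T i then 1 else 0) = card (T i)"
      using \<open>finite R\<close> by (simp add: sum.If_cases)
  qed simp
  also have "\<dots> \<le> card I * c"
    using sum_bounded_above[of I "\<lambda>i. card (T i)" c] small by simp
  finally have incidences: "(\<Sum>v\<in>R. card (S v)) \<le> card I * c" .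
  have "2 * card R = (\<Sum>v\<in>R. 2)" by simp
  \<comment> \<open>The two corrections lift the points of \<open>R0\<close> and \<open>R1\<close>
    to a contribution of 2 each.\<close>
  also have "\<dots> \<le> (\<Sum>v\<in>R. card (S v) + ((if S v = {} then 2 else 0) + (if card (S v) = 1 then 1 else 0)))"
  proof (rule sum_mono)
    fix v
    have "card (S v) = 0 \<longleftrightarrow> S v = {}" using fin by simp
    then show "2 \<le> card (S v) + ((if S v = {} then 2 else 0) + (if card (S v) = 1 then 1 else 0))"
      by (cases "S v = {}") auto
  qed
  also have "\<dots> = (\<Sum>v\<in>R. card (S v)) + 2 * card R0 + card R1"
    using \<open>finite R\<close> unfolding R0_def R1_def by (simp add: sum.distrib flip: sum.inter_filter)
  also have "\<dots> \<le> card I * c + 2 * 1 + card I"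
    using incidences R0 R1 by linarith
  finally show ?thesis by simp
qed

section \<open>Distances 1 and 2 under unit weights\<close>

context pair_graph
begin

lemma graph_dist_le_length:
  assumes "awalk u p v"
  shows "graph_dist G u v \<le> ereal (real (length p))"
proof -
  have "awalk_cost (\<lambda>_. 1) p = real (length p)"
    by (induction p) auto
  then show ?thesis
    using min_cost_le_walk_cost[OF assms, of "\<lambda>_. 1"] by (simp add: graph_dist_def)
qed

lemma graph_dist_geI:
  assumes "\<And>p. awalk u p v \<Longrightarrow> l \<le> length p"
  shows "ereal (real l) \<le> graph_dist G u v"
proof -
  have "awalk_cost (\<lambda>_. 1) p = real (length p)" for p :: "('a \<times> 'a) list"
    by (induction p) auto
  then show ?thesis
    using assms unfolding graph_dist_def \<mu>_def by (auto intro!: INF_greatest)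
qed

lemma graph_dist_arc:
  assumes "(u, v) \<in> parcs G"
  shows "graph_dist G u v = 1"
proof (rule antisym)
  have "awalk u [(u, v)] v"
    using arc_implies_awalk[of "(u, v)"] assms by simp
  from graph_dist_le_length[OF this] show "graph_dist G u v \<le> 1"
    by (simp add: one_ereal_def)
  have "u \<noteq> v" using assms no_loops' by auto
  then have "1 \<le> length p" if "awalk u p v" for p
    using that by (cases p) (auto simp: awalk_Nil_iff)
  from graph_dist_geI[OF this] show "1 \<le> graph_dist G u v"
    by (simp add: one_ereal_def)
qed

lemma graph_dist_two:
  assumes "(u, w) \<in> parcs G" "(w, v) \<in> parcs G" "u \<noteq> v" "(u, v) \<notin> parcs G"
  shows "graph_dist G u v = 2"
proof (rule antisym)
  have "awalk u [(u, w), (w, v)] v"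
    using assms by (auto simp: awalk_Cons_iff awalk_Nil_iff dest: in_arcsD2)
  from graph_dist_le_length[OF this] show "graph_dist G u v \<le> 2"
    by simp
  have "2 \<le> length p" if "awalk u p v" for p
  proof (rule ccontr)
    assume "\<not> 2 \<le> length p"
    then consider "p = []" | e where "p = [e]"
      by (cases p; cases "tl p") auto
    then show False
      using that assms(3,4) by cases (auto simp: awalk_Nil_iff awalk_Cons_iff)
  qed
  from graph_dist_geI[OF this] show "2 \<le> graph_dist G u v"
    by simp
qed

end

section \<open>Distances from a cell to the cells of a row\<close>

lemma latin_square_row_unique:
  assumes "latin_square n A" "(i, j) \<in> cells n" "(i, j') \<in> cells n" "A (i, j) = A (i, j')"
  shows "j = j'"
proof -
  have "A (i, j) \<in> {1..n}" "i \<in> {1..n}" "j \<in> {1..n}" "j' \<in> {1..n}"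
    using assms(1-3) by (auto simp: latin_square_def cells_def)
  moreover from this have "\<exists>!j''. j'' \<in> {1..n} \<and> A (i, j'') = A (i, j)"
    using assms(1) unfolding latin_square_def by blast
  ultimately show ?thesis
    using assms(4) by metis
qed

text \<open>A neighbour of \<open>u\<close> in another row shares its column, which leaves only
  \<open>(i, snd u)\<close>, or its symbol in some square \<open>A\<close> of \<open>L\<close>,
  which leaves at most one cell for each \<open>A\<close>.\<close>

lemma card_row_neighbours_le:
  assumes "is_MOLS k n L" "fst u \<noteq> i"
  shows "card {v \<in> {i} \<times> {1..n}. (u, v) \<in> parcs (latin_square_graph n L)} \<le> k + 1" (is "card ?N \<le> _")
proof -
  define C where "C A = {v \<in> {i} \<times> {1..n}. v \<in> cells n \<and> A v = A u}" for A :: "nat \<times> nat \<Rightarrow> nat"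
  have L: "finite L" "card L = k" "\<And>A. A \<in> L \<Longrightarrow> latin_square n A"
    using assms(1) by (auto simp: is_MOLS_def)
  have finC: "finite (C A)" for A
    by (rule finite_subset[of _ "{i} \<times> {1..n}"]) (auto simp: C_def)
  have C: "card (C A) \<le> 1" if "A \<in> L" for A
  proof -
    have "v = w" if "v \<in> C A" "w \<in> C A" for v w
      using latin_square_row_unique[OF L(3)[OF \<open>A \<in> L\<close>], of i "snd v" "snd w"] that
      by (cases v; cases w) (auto simp: C_def)
    then show ?thesis
      using card_le_Suc0_iff_eq[OF finC] by auto
  qed
  have "card ?N \<le> card ({(i, snd u)} \<union> (\<Union>A\<in>L. C A))"
    using assms(2) L(1) finC by (intro card_mono) (auto simp: C_def latin_square_graph_def)
  also have "\<dots> \<le> 1 + card (\<Union>A\<in>L. C A)"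
    using card_Un_le[of "{(i, snd u)}" "\<Union>A\<in>L. C A"] by simp
  also have "\<dots> \<le> 1 + (\<Sum>A\<in>L. card (C A))"
    using card_UN_le[OF L(1), of C] by simp
  also have "\<dots> \<le> 1 + k"
    using sum_bounded_above[of L "\<lambda>A. card (C A)" 1] C L(2) by simp
  finally show ?thesis by simp
qed

text \<open>If \<open>u\<close> lies in the row, \<open>T\<close> is \<open>{u}\<close> and all
  other cells are at distance 1. Otherwise \<open>T\<close> consists of the neighbours of
  \<open>u\<close> in the row, and the remaining cells are at distance 2.\<close>

lemma row_split_by_dist:
  fixes n :: nat
  assumes MOLS: "is_MOLS k n L" and i: "i \<in> {1..n}" and u: "u \<in> cells n"
  obtains T where "T \<subseteq> {i} \<times> {1..n}" "card T \<le> k + 1"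
    "\<And>v w. v \<in> {i} \<times> {1..n} \<Longrightarrow> w \<in> {i} \<times> {1..n} \<Longrightarrow> v \<in> T \<longleftrightarrow> w \<in> T \<Longrightarrow>
       graph_dist (latin_square_graph n L) u v = graph_dist (latin_square_graph n L) u w"
proof -
  let ?G = "latin_square_graph n L"
  interpret pair_graph ?G by (rule pair_graph_latin_square_graph)
  show thesis
  proof (cases "fst u = i")
    case True
    have "graph_dist ?G u v = 1" if "v \<in> {i} \<times> {1..n}" "v \<noteq> u" for v
      using that True i u by (intro graph_dist_arc) (auto simp: latin_square_graph_def cells_def)
    then show thesis
      using True u by (intro that[of "{u}"]) (auto simp: cells_def, metis)
  next
    case False
    let ?N = "{v \<in> {i} \<times> {1..n}. (u, v) \<in> parcs ?G}"
    have "graph_dist ?G u v = 2" if "v \<in> {i} \<times> {1..n}" "v \<notin> ?N" for v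
      \<comment> \<open>The midpoint shares the row of \<open>u\<close> and the column of
        \<open>v\<close>. It differs from \<open>u\<close>, since otherwise \<open>v\<close> would
        lie in the column of \<open>u\<close> and be a neighbour.\<close>
      by (rule graph_dist_two[of u "(fst u, snd v)"])
         (use that False i u in \<open>auto simp: latin_square_graph_def cells_def\<close>)
    moreover have "graph_dist ?G u v = 1" if "v \<in> ?N" for v
      using that by (intro graph_dist_arc) simp
    ultimately show thesis
      using card_row_neighbours_le[OF MOLS False]
      by (intro that[of ?N]) (blast, blast, metis (no_types, lifting))
  qed
qed

text \<open>With so few probes the sets \<open>T u\<close> cannot separate the row, by the counting
  bound with \<open>c = k + 1\<close>. Two cells lying in the same sets \<open>T u\<close> are at
  equal distance from every probe.\<close>

lemma twins_in_row:
  assumes MOLS: "is_MOLS k n L" and i: "i \<in> {1..n}" and us: "set us \<subseteq> cells n"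
    and few: "length us * (k + 2) + 2 < 2 * n"
  shows "\<exists>p\<in>{i} \<times> {1..n}. \<exists>q\<in>{i} \<times> {1..n}. p \<noteq> q \<and>
    (\<forall>u\<in>set us. graph_dist (latin_square_graph n L) u p = graph_dist (latin_square_graph n L) u q)"
proof -
  let ?d = "graph_dist (latin_square_graph n L)" and ?R = "{i} \<times> {1..n}"
  have "\<forall>u\<in>set us. \<exists>T. T \<subseteq> ?R \<and> card T \<le> k + 1 \<and>
      (\<forall>v\<in>?R. \<forall>w\<in>?R. (v \<in> T \<longleftrightarrow> w \<in> T) \<longrightarrow> ?d u v = ?d u w)"
  proof
    fix u assume "u \<in> set us"
    then have "u \<in> cells n" using us by blast
    then show "\<exists>T. T \<subseteq> ?R \<and> card T \<le> k + 1 \<and>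
        (\<forall>v\<in>?R. \<forall>w\<in>?R. (v \<in> T \<longleftrightarrow> w \<in> T) \<longrightarrow> ?d u v = ?d u w)"
      by (rule row_split_by_dist[OF MOLS i]) blast
  qed
  from bchoice[OF this] obtain T where T: "\<And>u. u \<in> set us \<Longrightarrow> T u \<subseteq> ?R \<and> card (T u) \<le> k + 1"
    and dist: "\<And>u v w. u \<in> set us \<Longrightarrow> v \<in> ?R \<Longrightarrow> w \<in> ?R \<Longrightarrow> v \<in> T u \<longleftrightarrow> w \<in> T u \<Longrightarrow> ?d u v = ?d u w"
    by blast
  define S where "S = (\<lambda>v. {u \<in> set us. v \<in> T u})"
  have "\<not> inj_on S ?R"
  proof
    assume "inj_on S ?R"
    then have "2 * card ?R \<le> card (set us) * (k + 1 + 1) + 2"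
      using T unfolding S_def by (intro separating_family_card_bound) auto
    \<comment> \<open>Several cops may probe the same vertex, so \<open>set us\<close> can be
      smaller than the list.\<close>
    also have "\<dots> \<le> length us * (k + 2) + 2"
      by (simp add: card_length mult_le_mono1 del: mult_Suc_right)
    finally show False
      using few by (simp add: card_cartesian_product)
  qed
  then obtain p q where pq: "p \<in> ?R" "q \<in> ?R" "p \<noteq> q" and eq: "S p = S q"
    unfolding inj_on_def by blast
  have "?d u p = ?d u q" if "u \<in> set us" for u
    by (rule dist) (use that pq(1,2) eq in \<open>auto simp: S_def\<close>)
  with pq show ?thesis by blast
qed

theorem theorem4p4:
  fixes k n :: nat and L :: "(nat \<times> nat \<Rightarrow> nat) set"
  assumes "0 < k" and "0 < n"
    and "is_MOLS k n L"
  shows "real (localization_number (latin_square_graph n L)) \<ge> 2 * (real n - 1) / (real k + 2)"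
proof -
  let ?G = "latin_square_graph n L"
  define m where "m = localization_number ?G"
  have verts: "pverts ?G = cells n"
    by (simp add: latin_square_graph_def)
  have "cells n \<noteq> {}"
    using assms(2) by (auto simp: cells_def)
  \<comment> \<open>The graph has a vertex, so the minimum in \<open>localization_number\<close> is
    attained and \<open>m\<close> cops do win.\<close>
  then have "cops_win ?G m"
    using localization_number_attained[OF pair_graph_latin_square_graph] verts by (simp add: m_def)
  moreover have "\<not> cops_win ?G m" if few: "m * (k + 2) + 2 < 2 * n"
  proof (rule not_cops_win_if_clique[of "{1} \<times> {1..n}"])
    show "\<exists>p\<in>{1} \<times> {1..n}. \<exists>q\<in>{1} \<times> {1..n}. p \<noteq> q \<and> (\<forall>u\<in>set us. graph_dist ?G u p = graph_dist ?G u q)"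
      if "length us = m" "set us \<subseteq> pverts ?G" for us
      using that few assms(2) verts by (intro twins_in_row[OF assms(3)]) auto
  qed (use assms(2) in \<open>auto simp: latin_square_graph_def cells_def\<close>)
  ultimately have "2 * n \<le> m * (k + 2) + 2"
    by force
  then have "real (2 * n) \<le> real (m * (k + 2) + 2)"
    by (simp only: of_nat_le_iff)
  then show ?thesis
    unfolding m_def[symmetric] by (simp add: divide_le_eq algebra_simps)
qed

end
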